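(* Let $p$ be an odd prime, let $g$ be an integer that is a generator modulo $p$, and let $c$ be an integer with $c \not\equiv 0 \pmod p$. Let $f(x) = x g^x - c$. Then the number of $x \in \{1, \dots, p(p-1) \mid x \not\equiv 0 \pmod p\}$ such that $f(x) \equiv 0 \pmod p$ is $p-1$, and the set of these solutions forms a complete residue system modulo $p-1$; in other words, the solutions are distinct modulo $p-1$.
   Context: An integer $g$ is a generator modulo $p$ if its class generates the multiplicative group $(\mathbb{Z}/p\mathbb{Z})^\times$. The notation $\{1,\dots,N \mid x\not\equiv 0 \pmod p\}$ denotes the set of integers $x$ with $1 \le x \le N$ and $p \nmid x$. *)

theory Defs
  imports "HOL-Number_Theory.Number_Theory" "HOL-Algebra.Generated_Groups"
begin

(* The class of g is represented by g mod p in the library's residue ring, whose carrier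
   is {0..p - 1}. *)
definition generator_mod :: "nat \<Rightarrow> int \<Rightarrow> bool" where
  "generator_mod p g \<longleftrightarrow>
     g mod int p \<in> carrier (units_of (residue_ring (int p))) \<and>
     generate (units_of (residue_ring (int p))) {g mod int p} =
       carrier (units_of (residue_ring (int p)))"

definition complete_residue_system :: "nat \<Rightarrow> nat set \<Rightarrow> bool" where
  "complete_residue_system m S \<longleftrightarrow> (\<forall>r::int. \<exists>!x. x \<in> S \<and> [int x = r] (mod int m))"

definition welch_fun :: "int \<Rightarrow> int \<Rightarrow> nat \<Rightarrow> int" where
  "welch_fun g c x = int x * g ^ x - c"

definition nonmultiples_upto :: "nat \<Rightarrow> nat \<Rightarrow> nat set" where
  "nonmultiples_upto p N = {x \<in> {1..N}. \<not> p dvd x}"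

definition welch_solutions :: "nat \<Rightarrow> int \<Rightarrow> int \<Rightarrow> nat set" where
  "welch_solutions p g c =
     {x \<in> nonmultiples_upto p (p * (p - 1)). [welch_fun g c x = 0] (mod int p)}"

end

theory Submission
  imports Defs
begin

(* On a fixed residue class r modulo p - 1, Fermat's little theorem makes g^x congruent to the
   constant g^r modulo p, so the equation becomes linear: x is congruent to c g^(-r) modulo p.
   As p and p - 1 are coprime, the Chinese remainder theorem gives exactly one solution below
   p (p - 1) in each class. *)

text \<open>The units of the residue ring are the residues coprime to \<open>p\<close>, and
  \<open>g mod int p\<close> lies in the unit group.\<close>

lemma generator_mod_coprime:
  assumes "generator_mod p g" and "1 < p"
  shows "coprime g (int p)"
proof -
  interpret residues "int p" "residue_ring (int p)"
    using assms(2) by unfold_locales simp_all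
  have "g mod int p \<in> Units (residue_ring (int p))"
    using assms(1) by (simp add: generator_mod_def units_of_carrier)
  then show ?thesis
    using assms(2) by (auto simp: res_units_eq coprime_commute)
qed

text \<open>Euler's theorem with \<open>totient p = p - 1\<close>; the base is an integer because
  \<open>g\<close> may be negative.\<close>

lemma fermat_theorem_int:
  fixes g :: int
  assumes "prime p" and "coprime g (int p)"
  shows "[g ^ (p - 1) = 1] (mod int p)"
proof -
  interpret residues "int p" "residue_ring (int p)"
    using prime_gt_1_nat[OF assms(1)] by unfold_locales simp_all
  show ?thesis
    using euler_theorem[OF assms(2)] assms(1) by (simp add: totient_prime)
qed

text \<open>Splitting the exponent \<open>z\<close> into \<open>z div k\<close> blocks of length
  \<open>k\<close> and a remainder, each block contributes a factor congruent to 1, so the power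
  depends only on \<open>z mod k\<close>.\<close>

lemma power_cong_exponent:
  fixes a m :: "'a :: unique_euclidean_semiring"
  assumes "[a ^ k = 1] (mod m)" and "[x = y] (mod k)"
  shows "[a ^ x = a ^ y] (mod m)"
proof -
  have reduce: "[a ^ z = a ^ (z mod k)] (mod m)" for z
  proof -
    have "a ^ z = (a ^ k) ^ (z div k) * a ^ (z mod k)"
      by (simp flip: power_mult power_add)
    moreover have "[(a ^ k) ^ (z div k) * a ^ (z mod k) = 1 ^ (z div k) * a ^ (z mod k)] (mod m)"
      by (intro cong_mult cong_pow assms(1) cong_refl)
    ultimately show ?thesis
      by simp
  qed
  show ?thesis
    using reduce[of x] reduce[of y] assms(2) by (metis cong_def)
qed

lemma complete_residue_system_unique:
  assumes "complete_residue_system m S" and "x \<in> S" and "y \<in> S" and "[x = y] (mod m)"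
  shows "x = y"
  using assms cong_int_iff cong_refl unfolding complete_residue_system_def by metis

text \<open>Reduction modulo \<open>m\<close> is a bijection from \<open>S\<close> onto
  \<open>{..<m}\<close>: uniqueness of representatives gives injectivity, existence gives
  surjectivity.\<close>

lemma card_complete_residue_system:
  assumes "complete_residue_system m S" and "0 < m"
  shows "card S = m"
proof -
  have "bij_betw (\<lambda>x. x mod m) S {..<m}"
  proof (rule bij_betw_imageI)
    show "inj_on (\<lambda>x. x mod m) S"
      using complete_residue_system_unique[OF assms(1)] by (auto simp: inj_on_def cong_def)
    show "(\<lambda>x. x mod m) ` S = {..<m}"
    proof (intro equalityI subsetI)
      fix r assume r: "r \<in> {..<m}"
      obtain x where "x \<in> S" "[int x = int r] (mod int m)"
        using assms(1) unfolding complete_residue_system_def by blast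
      with r show "r \<in> (\<lambda>x. x mod m) ` S"
        by (intro image_eqI[of _ _ x]) (auto simp: cong_int_iff cong_def[of x r])
    qed (use assms(2) in auto)
  qed
  then show ?thesis
    by (simp add: bij_betw_same_card[of _ S "{..<m}"])
qed

text \<open>Since \<open>c\<close> is nonzero modulo \<open>p\<close>, the congruence has no
  solution divisible by \<open>p\<close>. In particular 0 and \<open>p * (p - 1)\<close> are
  excluded, so the range from 1 to \<open>p * (p - 1)\<close> can be traded for
  \<open>x < p * (p - 1)\<close>, the range in which the Chinese remainder theorem gives
  uniqueness.\<close>

lemma mem_welch_solutions_iff:
  assumes "prime p" and "\<not> [c = 0] (mod int p)"
  shows "x \<in> welch_solutions p g c \<longleftrightarrow> x < p * (p - 1) \<and> [int x * g ^ x = c] (mod int p)"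
proof -
  have "\<not> p dvd x" if "[int x * g ^ x = c] (mod int p)"
  proof
    assume "p dvd x"
    then have "[int x * g ^ x = 0] (mod int p)"
      by (simp add: cong_0_iff)
    with that assms(2) show False
      by (metis cong_sym cong_trans)
  qed
  moreover have "0 < x" if "\<not> p dvd x"
    using that by (cases x) simp_all
  moreover have "x \<noteq> p * (p - 1)" if "\<not> p dvd x"
    using that by auto
  ultimately show ?thesis
    unfolding welch_solutions_def nonmultiples_upto_def welch_fun_def
    by (auto simp: cong_diff_iff_cong_0 Suc_le_eq)
qed

lemma complete_residue_system_welch_solutions:
  fixes p :: nat and g c :: int
  assumes "prime p" and "coprime g (int p)" and "\<not> [c = 0] (mod int p)"
  shows "complete_residue_system (p - 1) (welch_solutions p g c)"
  unfolding complete_residue_system_def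
proof
  fix r :: int
  have p: "1 < p"
    using assms(1) by (rule prime_gt_1_nat)
  \<comment> \<open>The class \<open>r\<close> is an arbitrary integer, possibly negative;
    \<open>s\<close> is a natural representative, usable as an exponent.\<close>
  define s where "s = nat (r mod int (p - 1))"
  have s: "[int x = r] (mod int (p - 1)) \<longleftrightarrow> [x = s] (mod (p - 1))" for x
  proof -
    have "int s = r mod int (p - 1)"
      using p by (simp add: s_def)
    then show ?thesis
      unfolding cong_int_iff[symmetric] by (simp add: cong_def)
  qed
  have cop: "coprime (g ^ s) (int p)"
    using assms(2) by simp
  then obtain h where h: "[g ^ s * h = 1] (mod int p)"
    using cong_solve_coprime_int by blast
  \<comment> \<open>As \<open>h\<close> inverts \<open>g ^ s\<close> modulo \<open>p\<close>,
    \<open>u\<close> is the natural representative of the root of the linear congruence.\<close>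
  define u where "u = nat (h * c mod int p)"
  have int_u: "int u = h * c mod int p"
    using p by (simp add: u_def)
  have gu: "[int u * g ^ s = c] (mod int p)"
  proof -
    have "[int u * g ^ s = h * c * g ^ s] (mod int p)"
      by (simp add: int_u cong_def mod_mult_left_eq)
    also have "h * c * g ^ s = g ^ s * h * c"
      by (simp add: mult_ac)
    also have "[g ^ s * h * c = 1 * c] (mod int p)"
      by (intro cong_mult h cong_refl)
    finally show ?thesis
      by simp
  qed
  have linear: "[int x * g ^ x = c] (mod int p) \<longleftrightarrow> [x = u] (mod p)"
    if "[x = s] (mod (p - 1))" for x
  proof -
    have "[g ^ x = g ^ s] (mod int p)"
      using fermat_theorem_int[OF assms(1,2)] that by (rule power_cong_exponent)
    then have "[int x * g ^ x = int x * g ^ s] (mod int p)"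
      by (intro cong_mult cong_refl)
    then have "[int x * g ^ x = c] (mod int p) \<longleftrightarrow> [int x * g ^ s = int u * g ^ s] (mod int p)"
      using gu by (metis cong_sym cong_trans)
    then show ?thesis
      \<comment> \<open>The factor \<open>g ^ s\<close> is a unit modulo \<open>p\<close>, so it
        cancels.\<close>
      using cong_mult_rcancel[OF cop] by (simp add: cong_int_iff)
  qed
  have "coprime p (p - 1)"
    using p coprime_diff_one_right_nat[of p] by simp
  then have "\<exists>!x. x < p * (p - 1) \<and> [x = u] (mod p) \<and> [x = s] (mod (p - 1))"
    using p by (intro binary_chinese_remainder_unique_nat) simp_all
  \<comment> \<open>Inside the class of \<open>r\<close>, being a solution is the same as satisfying
    the two simultaneous congruences, so unique existence carries over.\<close>
  moreover have "x \<in> welch_solutions p g c \<and> [int x = r] (mod int (p - 1)) \<longleftrightarrow>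
      x < p * (p - 1) \<and> [x = u] (mod p) \<and> [x = s] (mod (p - 1))" for x
    using linear mem_welch_solutions_iff[OF assms(1,3)] s by blast
  ultimately show "\<exists>!x. x \<in> welch_solutions p g c \<and> [int x = r] (mod int (p - 1))"
    by simp
qed

theorem theorem1:
  fixes p :: nat and g c :: int
  assumes "prime p" and "odd p"
    and "generator_mod p g"
    and "\<not> [c = 0] (mod int p)"
  shows "card (welch_solutions p g c) = p - 1
    \<and> complete_residue_system (p - 1) (welch_solutions p g c)
    \<and> (\<forall>x \<in> welch_solutions p g c. \<forall>y \<in> welch_solutions p g c.
          [x = y] (mod (p - 1)) \<longrightarrow> x = y)"
proof -
  have p: "1 < p"
    using assms(1) by (rule prime_gt_1_nat)
  have "complete_residue_system (p - 1) (welch_solutions p g c)"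
    using assms(1) generator_mod_coprime[OF assms(3) p] assms(4)
    by (rule complete_residue_system_welch_solutions)
  then show ?thesis
    using card_complete_residue_system complete_residue_system_unique p
    by (metis zero_less_diff)
qed

end
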